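(* Let $\alpha>0$, $\lambda\in\mathbb{R}$, $h>0$, let $n$ and $j$ be integers with $0\le j\le n-1$, and let $\mathcal{Q}_{n,j}[f]=\sum_{r=1}^{\nu} b_r(n-j)\,f(t_j+c_rh)$ be a quadrature rule with nodes $c_1,\dots,c_\nu\in[0,1]$ and weights $b_1(n-j),\dots,b_\nu(n-j)$, used to approximate $\mathcal{I}_j[f,t_n]=\int_{t_j}^{t_{j+1}} e_{\alpha,\alpha}(t_n-s;\lambda)\, f(s)\,ds$. Then $\mathcal{Q}_{n,j}$ has degree of precision $d$ if and only if $$\sum_{r=1}^{\nu} b_r(n-j)\, c_r^k = R_{\alpha,k}(n-j;h^{\alpha}\lambda),\qquad k=0,1,\dots,d,$$ where $R_{\alpha,k}(n-j;h^{\alpha}\lambda)=k!\,h^{\alpha}\, R_{\alpha,\alpha,k}(n-j,0,1;h^{\alpha}\lambda)$.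
   Context: The points $t_i=t_0+ih$ form an equispaced mesh with step-size $h>0$ on an interval $[t_0,T]$. The Mittag--Leffler function is $E_{\alpha,\beta}(z)=\sum_{k=0}^\infty \frac{z^k}{\Gamma(\alpha k+\beta)}$, and $e_{\alpha,\beta}(t;z)=t^{\beta-1}E_{\alpha,\beta}(-t^\alpha z)$. For $a<b\le t$ and integer $k\ge 0$, $$R_{\alpha,\beta,k}(t,a,b;z)=\frac{1}{\Gamma(k+1)}\int_a^b e_{\alpha,\beta}(t-s;z)(s-a)^k\,ds .$$ Definition: the quadrature rule $\mathcal{Q}_{n,j}$ is said to have degree of precision $d$ if it is exact (that is, $\mathcal{I}_j[p,t_n]=\mathcal{Q}_{n,j}[p]$) for any polynomial $p$ of degree not exceeding $d$ but it is not exact for polynomials of degree $d+1$.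
   Formalization: The "if" fails as stated (midpoint rule, α=1, λ=0, d=0 is exact in degree 1 too). Proved instead: exactness up to degree d iff the conditions hold for k=0,…,d; degree of precision d iff they hold for k=0,…,d and the condition fails for k=d+1. *)

theory Defs
  imports "HOL-Analysis.Analysis"
begin

definition mittag_leffler :: "real \<Rightarrow> real \<Rightarrow> real \<Rightarrow> real" where
  "mittag_leffler \<alpha> \<beta> z = (\<Sum>k. z ^ k / Gamma (\<alpha> * real k + \<beta>))"

(* At t = 0 the factor t powr (\<beta> - 1) is 0 for every \<beta>, also for 0 < \<beta> \<le> 1, where the
   kernel tends to 1 (\<beta> = 1) or is singular (\<beta> < 1). The kernel only occurs under integrals over
   intervals, where the value at this single point is irrelevant. *)
definition ml_kernel :: "real \<Rightarrow> real \<Rightarrow> real \<Rightarrow> real \<Rightarrow> real" where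
  "ml_kernel \<alpha> \<beta> t z = t powr (\<beta> - 1) * mittag_leffler \<alpha> \<beta> (- (t powr \<alpha>) * z)"

definition ml_R :: "real \<Rightarrow> real \<Rightarrow> nat \<Rightarrow> real \<Rightarrow> real \<Rightarrow> real \<Rightarrow> real \<Rightarrow> real" where
  "ml_R \<alpha> \<beta> k t a b z =
     1 / Gamma (real k + 1) * integral {a..b} (\<lambda>s. ml_kernel \<alpha> \<beta> (t - s) z * (s - a) ^ k)"

definition mesh :: "real \<Rightarrow> real \<Rightarrow> nat \<Rightarrow> real" where
  "mesh t0 h i = t0 + real i * h"

definition ml_integral ::
  "real \<Rightarrow> real \<Rightarrow> real \<Rightarrow> real \<Rightarrow> nat \<Rightarrow> nat \<Rightarrow> (real \<Rightarrow> real) \<Rightarrow> real" where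
  "ml_integral \<alpha> lam t0 h n j f =
     integral {mesh t0 h j..mesh t0 h (j + 1)}
       (\<lambda>s. ml_kernel \<alpha> \<alpha> (mesh t0 h n - s) lam * f s)"

(* The weights are functions of the index difference n - j. *)
definition quad_rule ::
  "nat \<Rightarrow> (nat \<Rightarrow> nat \<Rightarrow> real) \<Rightarrow> (nat \<Rightarrow> real) \<Rightarrow> real \<Rightarrow> real \<Rightarrow> nat \<Rightarrow> nat \<Rightarrow>
   (real \<Rightarrow> real) \<Rightarrow> real" where
  "quad_rule \<nu> b c t0 h n j f = (\<Sum>r=1..\<nu>. b r (n - j) * f (mesh t0 h j + c r * h))"

definition exact_up_to_degree ::
  "((real \<Rightarrow> real) \<Rightarrow> real) \<Rightarrow> ((real \<Rightarrow> real) \<Rightarrow> real) \<Rightarrow> nat \<Rightarrow> bool" where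
  "exact_up_to_degree I Q d \<longleftrightarrow> (\<forall>p :: real poly. degree p \<le> d \<longrightarrow> I (poly p) = Q (poly p))"

(* The conditions sum_r b_r(n-j) c_r^k = R_(alpha,k)(n-j; h^alpha lam),
   for k = 0, ..., d characterise exactness up to degree d. They do not exclude
   exactness in degree d + 1: for \<alpha> = 1, lam = 0, h = 1, n = 1, j = 0, the midpoint
   rule satisfies the condition for k = 0 but has degree of precision 1, not 0. The exact
   degree of precision is d iff, in addition, the condition for k = d + 1 fails. *)
definition has_degree_of_precision ::
  "((real \<Rightarrow> real) \<Rightarrow> real) \<Rightarrow> ((real \<Rightarrow> real) \<Rightarrow> real) \<Rightarrow> nat \<Rightarrow> bool" where
  "has_degree_of_precision I Q d \<longleftrightarrow>
     exact_up_to_degree I Q d \<and>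
     \<not> (\<forall>p :: real poly. degree p = d + 1 \<longrightarrow> I (poly p) = Q (poly p))"

definition order_R :: "real \<Rightarrow> real \<Rightarrow> nat \<Rightarrow> nat \<Rightarrow> real \<Rightarrow> real" where
  "order_R \<alpha> h k m z = fact k * h powr \<alpha> * ml_R \<alpha> \<alpha> k (real m) 0 1 z"

end

theory Submission
  imports Defs "HOL-Real_Asymp.Real_Asymp"
begin

text \<open>The kernel is the integrable power \<open>x powr (\<beta> - 1)\<close> times a continuous function, because the
  Mittag-Leffler series converges on the whole line; hence integration against the kernel is linear
  on polynomials. The substitution \<open>s = t\<^sub>j + u h\<close> preserves degrees and, by homogeneity
  of the kernel, turns both the integral and the quadrature rule into functionals on \<open>[0, 1]\<close> that
  do not depend on \<open>t\<^sub>0\<close>. The conditions of the theorem say that the difference of these two linear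
  functionals vanishes on the monomials \<open>u ^ k\<close>.\<close>

text \<open>Euler's integral is bounded below by its part over \<open>{M..M+1}\<close>: since
  \<open>x \<ge> 1\<close>, the power is smallest at the left end, and the exponential factor is
  smallest at the right end. As \<open>M\<close> is free, \<open>Gamma\<close> outgrows every
  geometric sequence.\<close>

lemma Gamma_real_ge:
  fixes x M :: real
  assumes "x \<ge> 1" "M \<ge> 0"
  shows "M powr (x - 1) * exp (- (M + 1)) \<le> Gamma x"
proof -
  define C where "C = M powr (x - 1) * exp (- (M + 1))"
  have "((\<lambda>t. C) has_integral C) {M..M+1}"
    using has_integral_const_real[of C M "M + 1"] by simp
  then have "((\<lambda>t. if t \<in> {M..M+1} then C else 0) has_integral C) {0..}"
    by (subst has_integral_restrict) (use assms in auto)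
  moreover have "((\<lambda>t. t powr (x - 1) / exp t) has_integral Gamma x) {0..}"
    using assms by (intro Gamma_integral_real) simp
  moreover have "(if t \<in> {M..M+1} then C else 0) \<le> t powr (x - 1) / exp t" for t
  proof (cases "t \<in> {M..M+1}")
    case True
    have "C \<le> t powr (x - 1) * exp (- t)"
      unfolding C_def using True assms by (intro mult_mono powr_mono2) auto
    then show ?thesis
      using True by (simp add: exp_minus divide_inverse)
  qed auto
  ultimately show ?thesis
    unfolding C_def by (rule has_integral_le)
qed

lemma summable_mittag_leffler:
  fixes \<alpha> \<beta> z :: real
  assumes "\<alpha> > 0"
  shows "summable (\<lambda>k. z ^ k / Gamma (\<alpha> * real k + \<beta>))"
proof -
  \<comment> \<open>With this \<open>M\<close>, the factor \<open>M powr (\<alpha> * real k)\<close>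
    equals \<open>(2 * \<bar>z\<bar> + 1) ^ k\<close>, which beats \<open>\<bar>z\<bar> ^ k\<close>
    by \<open>2 ^ k\<close>. The constant \<open>A\<close> collects what does not depend on
    \<open>k\<close>.\<close>
  define M where "M = (2 * \<bar>z\<bar> + 1) powr (1 / \<alpha>)"
  have M: "M > 0" and M_powr: "M powr \<alpha> = 2 * \<bar>z\<bar> + 1"
    using assms by (simp_all add: M_def powr_powr)
  define A where "A = exp (M + 1) * M powr (1 - \<beta>)"
  have A: "A > 0"
    using M by (simp add: A_def)
  \<comment> \<open>For small \<open>k\<close> the argument may lie below 1 or even at a pole of
    \<open>Gamma\<close>, so the comparison is only claimed eventually.\<close>
  have "\<forall>\<^sub>F k in sequentially. \<alpha> * real k + \<beta> \<ge> 1"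
    using assms by real_asymp
  then have "\<forall>\<^sub>F k in sequentially. norm (z ^ k / Gamma (\<alpha> * real k + \<beta>)) \<le> A * (1 / 2) ^ k"
  proof eventually_elim
    case (elim k)
    have "M powr (\<alpha> * real k + \<beta> - 1) = (M powr \<alpha>) powr real k * M powr (\<beta> - 1)"
      by (simp add: powr_powr add_diff_eq flip: powr_add)
    also have "\<dots> = (2 * \<bar>z\<bar> + 1) ^ k * M powr (\<beta> - 1)"
      unfolding M_powr by (subst powr_realpow) auto
    finally have "M powr (\<alpha> * real k + \<beta> - 1) = (2 * \<bar>z\<bar> + 1) ^ k * M powr (\<beta> - 1)" .
    moreover have "M powr (\<beta> - 1) * exp (- (M + 1)) = 1 / A"
      using M by (simp only: A_def exp_minus powr_diff) (simp add: divide_simps)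
    ultimately have "(2 * \<bar>z\<bar> + 1) ^ k / A \<le> Gamma (\<alpha> * real k + \<beta>)"
      using Gamma_real_ge[OF elim, of M] M by (simp add: mult.assoc)
    moreover have "\<bar>z\<bar> ^ k * 2 ^ k \<le> (2 * \<bar>z\<bar> + 1) ^ k"
      unfolding power_mult_distrib[symmetric] by (intro power_mono) auto
    ultimately have "\<bar>z\<bar> ^ k * 2 ^ k \<le> A * Gamma (\<alpha> * real k + \<beta>)"
      using A by (simp add: field_simps)
    moreover have "Gamma (\<alpha> * real k + \<beta>) > 0"
      using elim by (intro Gamma_real_pos) simp
    ultimately show ?case
      by (simp add: power_abs abs_mult field_simps)
  qed
  then show ?thesis
    by (rule summable_comparison_test_ev) (auto intro!: summable_mult summable_geometric)
qed

lemma continuous_on_mittag_leffler: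
  assumes "\<alpha> > 0"
  shows "continuous_on S (mittag_leffler \<alpha> \<beta>)"
proof -
  have "isCont (\<lambda>x. \<Sum>k. (1 / Gamma (\<alpha> * real k + \<beta>)) * x ^ k) x" for x
    using summable_mittag_leffler[OF assms, of _ \<beta>]
    by (intro isCont_powser_converges_everywhere) simp
  then show ?thesis
    by (auto intro!: continuous_at_imp_continuous_on simp: mittag_leffler_def[abs_def])
qed

text \<open>For \<open>\<beta> > 0\<close> the power is absolutely integrable down to 0, and a
  bounded measurable factor preserves this.\<close>

lemma integrable_powr_mult_continuous:
  fixes f :: "real \<Rightarrow> real"
  assumes "\<beta> > 0" "0 \<le> a" "a \<le> b" "continuous_on {0..b} f"
  shows "(\<lambda>x. x powr (\<beta> - 1) * f x) integrable_on {a..b}"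
proof -
  have "(\<lambda>x. x powr (\<beta> - 1)) absolutely_integrable_on {0..b}"
    using assms by (intro nonnegative_absolutely_integrable_1 integrable_on_powr_from_0) auto
  moreover have "bounded (f ` {0..b})"
    using assms(4) by (intro compact_imp_bounded compact_continuous_image) auto
  moreover have "f \<in> borel_measurable (lebesgue_on {0..b})"
    using assms(4) by (intro continuous_imp_measurable_on_sets_lebesgue) auto
  ultimately have "(\<lambda>x. f x * x powr (\<beta> - 1)) absolutely_integrable_on {0..b}"
    by (intro absolutely_integrable_bounded_measurable_product_real) auto
  then have "(\<lambda>x. x powr (\<beta> - 1) * f x) integrable_on {0..b}"
    by (simp add: mult.commute absolutely_integrable_on_def)
  then show ?thesis
    using assms by (elim integrable_subinterval_real) auto
qed

text \<open>The reflection \<open>x = t - s\<close> moves the possible singularity from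
  \<open>s = t\<close> to 0. The case \<open>b = t\<close> is allowed; it occurs on the last mesh
  interval before \<open>t\<close>.\<close>

lemma ml_kernel_mult_integrable:
  fixes f :: "real \<Rightarrow> real"
  assumes "\<alpha> > 0" "\<beta> > 0" "a \<le> b" "b \<le> t" "continuous_on {a..t} f"
  shows "(\<lambda>s. ml_kernel \<alpha> \<beta> (t - s) z * f s) integrable_on {a..b}"
proof -
  define g where "g = (\<lambda>x. mittag_leffler \<alpha> \<beta> (- (x powr \<alpha>) * z) * f (t - x))"
  have "continuous_on {0..t-a} (\<lambda>x. mittag_leffler \<alpha> \<beta> (- (x powr \<alpha>) * z))"
    using assms
    by (intro continuous_on_compose2[OF continuous_on_mittag_leffler[of _ UNIV]]
        continuous_on_mult continuous_on_minus continuous_on_powr' continuous_intros) auto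
  moreover have "continuous_on {0..t-a} (\<lambda>x. f (t - x))"
    by (rule continuous_on_compose2[OF assms(5)]) (auto intro!: continuous_intros)
  ultimately have "continuous_on {0..t-a} g"
    unfolding g_def by (intro continuous_on_mult)
  then have "(\<lambda>x. x powr (\<beta> - 1) * g x) integrable_on {t-b..t-a}"
    using assms by (intro integrable_powr_mult_continuous) auto
  from integrable_affinity[of _ "t - b" "t - a" "-1" t, unfolded box_real, OF this]
  have "(\<lambda>s. (t - s) powr (\<beta> - 1) * g (t - s)) integrable_on ((\<lambda>x. t - x) ` {t-b..t-a})"
    by simp
  moreover have "(\<lambda>x. t - x) ` {t-b..t-a} = {a..b}"
    by (simp add: image_diff_atLeastAtMost)
  ultimately show ?thesis
    by (simp add: g_def ml_kernel_def mult_ac)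
qed

text \<open>The Mittag-Leffler factor sees \<open>h\<close> only through
  \<open>h powr \<alpha>\<close>, which moves into the parameter; this is the origin of
  \<open>h powr \<alpha> * lam\<close> in the conditions.\<close>

lemma ml_kernel_scale:
  assumes "h > 0" "x \<ge> 0"
  shows "ml_kernel \<alpha> \<beta> (h * x) z = h powr (\<beta> - 1) * ml_kernel \<alpha> \<beta> x (h powr \<alpha> * z)"
  using assms by (simp add: ml_kernel_def powr_mult mult_ac)

lemma ml_integral_poly:
  assumes "\<alpha> > 0" "h > 0" "j < n"
  shows "ml_integral \<alpha> lam t0 h n j (poly p) =
    (\<Sum>k\<le>degree p. coeff (pcompose p [:mesh t0 h j, h:]) k
                     * order_R \<alpha> h k (n - j) (h powr \<alpha> * lam))"
proof -
  define q where "q = pcompose p [:mesh t0 h j, h:]"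
  define K where "K = (\<lambda>u. ml_kernel \<alpha> \<alpha> (real (n - j) - u) (h powr \<alpha> * lam))"
  define F where "F = (\<lambda>s. ml_kernel \<alpha> \<alpha> (mesh t0 h n - s) lam * poly p s)"
  have deg_q: "degree q = degree p"
    using assms by (simp add: q_def degree_pcompose)
  have mesh_diff: "mesh t0 h n - mesh t0 h j = h * real (n - j)"
    using assms by (simp add: mesh_def of_nat_diff algebra_simps)
  have mesh_Suc: "mesh t0 h (Suc j) = mesh t0 h j + h"
    by (simp add: mesh_def algebra_simps)
  have nj: "real (n - j) \<ge> 1"
    using assms by simp
  have "h * real (n - j) \<ge> h * 1"
    using assms nj by (intro mult_left_mono) auto
  \<comment> \<open>Here \<open>j < n\<close> enters: the singularity at \<open>mesh t0 h n\<close>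
    is at worst the right endpoint of the interval.\<close>
  then have "mesh t0 h (Suc j) \<le> mesh t0 h n"
    using mesh_diff mesh_Suc by linarith
  then have "F integrable_on {mesh t0 h j..mesh t0 h (Suc j)}"
    unfolding F_def using assms mesh_Suc
    by (intro ml_kernel_mult_integrable continuous_intros) auto
  then have "(F has_integral ml_integral \<alpha> lam t0 h n j (poly p))
      (cbox (mesh t0 h j) (mesh t0 h j + h))"
    by (simp add: ml_integral_def F_def mesh_Suc integrable_integral)
  from has_integral_affinity'[OF this \<open>h > 0\<close>, of "mesh t0 h j"]
  have F_int: "((\<lambda>u. F (h * u + mesh t0 h j)) has_integral
      ml_integral \<alpha> lam t0 h n j (poly p) / h) {0..1}"
    using assms by (simp add: field_simps)
  have F_eq: "F (h * u + mesh t0 h j) = h powr (\<alpha> - 1) * (K u * poly q u)" if "u \<in> {0..1}" for u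
  proof -
    have "mesh t0 h n - (h * u + mesh t0 h j) = h * (real (n - j) - u)"
      using mesh_diff by (simp add: algebra_simps)
    moreover have "real (n - j) - u \<ge> 0"
      using that nj by (simp del: of_nat_diff_if of_nat_diff)
    ultimately show ?thesis
      using assms by (simp add: F_def K_def q_def poly_pcompose ml_kernel_scale add_ac mult_ac)
  qed
  have K_int: "(\<lambda>u. K u * u ^ k) integrable_on {0..1}" for k
    unfolding K_def using assms nj by (intro ml_kernel_mult_integrable continuous_intros) auto
  have "integral {0..1} (\<lambda>u. F (h * u + mesh t0 h j)) =
      integral {0..1} (\<lambda>u. h powr (\<alpha> - 1) * (K u * poly q u))"
    by (rule integral_cong) (rule F_eq)
  then have "ml_integral \<alpha> lam t0 h n j (poly p) =
      h * integral {0..1} (\<lambda>u. h powr (\<alpha> - 1) * (K u * poly q u))"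
    using integral_unique[OF F_int] assms by (simp add: field_simps)
  \<comment> \<open>The factor \<open>h\<close> from the substitution and
    \<open>h powr (\<alpha> - 1)\<close> from the kernel combine.\<close>
  also have "\<dots> = h powr \<alpha> * integral {0..1} (\<lambda>u. K u * poly q u)"
    using assms by (simp add: powr_diff)
  also have "(\<lambda>u. K u * poly q u) = (\<lambda>u. \<Sum>k\<le>degree q. coeff q k * (K u * u ^ k))"
    by (simp add: poly_altdef sum_distrib_left mult_ac)
  also have "integral {0..1} \<dots> = (\<Sum>k\<le>degree q. coeff q k * integral {0..1} (\<lambda>u. K u * u ^ k))"
    using K_int by (subst integral_sum) (auto intro!: integrable_on_mult_right)
  \<comment> \<open>The \<open>fact k\<close> in \<open>order_R\<close> cancels the
    \<open>1 / Gamma (real k + 1)\<close> in \<open>ml_R\<close>, leaving the plain moment.\<close>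
  also have "h powr \<alpha> * \<dots> =
      (\<Sum>k\<le>degree q. coeff q k * order_R \<alpha> h k (n - j) (h powr \<alpha> * lam))"
    by (simp add: order_R_def ml_R_def K_def Gamma_fact add_ac sum_distrib_left mult_ac)
  finally show ?thesis
    by (simp add: deg_q q_def[symmetric])
qed

text \<open>The coefficients are those of \<open>ml_integral_poly\<close>, so integral and rule
  differ only in their moments.\<close>

lemma quad_rule_poly:
  assumes "h \<noteq> 0"
  shows "quad_rule \<nu> b c t0 h n j (poly p) =
    (\<Sum>k\<le>degree p. coeff (pcompose p [:mesh t0 h j, h:]) k
                     * (\<Sum>r=1..\<nu>. b r (n - j) * c r ^ k))"
proof -
  define q where "q = pcompose p [:mesh t0 h j, h:]"
  have deg_q: "degree q = degree p"
    using assms by (simp add: q_def degree_pcompose)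
  have "quad_rule \<nu> b c t0 h n j (poly p) = (\<Sum>r=1..\<nu>. b r (n - j) * poly q (c r))"
    by (simp add: quad_rule_def q_def poly_pcompose)
  also have "\<dots> = (\<Sum>r=1..\<nu>. \<Sum>k\<le>degree q. coeff q k * (b r (n - j) * c r ^ k))"
    by (simp add: poly_altdef sum_distrib_left mult_ac)
  also have "\<dots> = (\<Sum>k\<le>degree q. coeff q k * (\<Sum>r=1..\<nu>. b r (n - j) * c r ^ k))"
    by (subst sum.swap) (simp add: sum_distrib_left)
  finally show ?thesis
    by (simp add: deg_q q_def[symmetric])
qed

lemma pcompose_linear_surj:
  fixes a h :: "'a::field"
  assumes "h \<noteq> 0"
  obtains p where "pcompose p [:a, h:] = q" "degree p = degree q"
proof
  show "pcompose (pcompose q [:- a / h, 1 / h:]) [:a, h:] = q"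
    using assms by (simp add: pcompose_assoc[symmetric] pcompose_pCons)
  show "degree (pcompose q [:- a / h, 1 / h:]) = degree q"
    using assms by (simp add: degree_pcompose)
qed

text \<open>Equal moments make the two expansions agree term by term; conversely, a polynomial that
  becomes a single monomial in the local variable isolates one moment.\<close>

lemma exact_degree_iff_moments:
  fixes I Q :: "(real \<Rightarrow> real) \<Rightarrow> real" and \<mu> \<sigma> :: "nat \<Rightarrow> real"
  assumes h: "h \<noteq> 0"
    and I: "\<And>p. I (poly p) = (\<Sum>k\<le>degree p. coeff (pcompose p [:a, h:]) k * \<mu> k)"
    and Q: "\<And>p. Q (poly p) = (\<Sum>k\<le>degree p. coeff (pcompose p [:a, h:]) k * \<sigma> k)"
  shows "exact_up_to_degree I Q d \<longleftrightarrow> (\<forall>k\<le>d. \<sigma> k = \<mu> k)" (is ?exact)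
    and "has_degree_of_precision I Q d \<longleftrightarrow> (\<forall>k\<le>d. \<sigma> k = \<mu> k) \<and> \<sigma> (d + 1) \<noteq> \<mu> (d + 1)" (is ?prec)
proof -
  have monomial: "\<exists>p. degree p = k \<and> I (poly p) = \<mu> k \<and> Q (poly p) = \<sigma> k" for k
  proof -
    \<comment> \<open>This \<open>p\<close> is the \<open>k\<close>-th power of
      \<open>(s - a) / h\<close>, of degree exactly \<open>k\<close>.\<close>
    obtain p where p: "pcompose p [:a, h:] = monom 1 k" "degree p = degree (monom (1::real) k)"
      using pcompose_linear_surj[OF h] .
    have "(\<Sum>i\<le>k. coeff (monom 1 k) i * f i) = f k" for f :: "nat \<Rightarrow> real"
      by (simp add: if_distrib[of "\<lambda>x. x * _"] cong: if_cong)
    then show ?thesis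
      using p by (intro exI[of _ p]) (simp add: I Q degree_monom_eq)
  qed
  have exact: "I (poly p) = Q (poly p)" if "degree p \<le> m" "\<forall>k\<le>m. \<sigma> k = \<mu> k" for p m
    using that by (simp add: I Q)
  show ?exact
    unfolding exact_up_to_degree_def using monomial exact by (metis order_refl)
  \<comment> \<open>A polynomial of degree \<open>d + 1\<close> also has lower-order terms; the
    moments up to \<open>d\<close> take care of these, so only moment \<open>d + 1\<close>
    decides.\<close>
  moreover have "(\<forall>p. degree p = d + 1 \<longrightarrow> I (poly p) = Q (poly p)) \<longleftrightarrow> \<sigma> (d + 1) = \<mu> (d + 1)"
    if "\<forall>k\<le>d. \<sigma> k = \<mu> k"
  proof
    assume "\<forall>p. degree p = d + 1 \<longrightarrow> I (poly p) = Q (poly p)"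
    then show "\<sigma> (d + 1) = \<mu> (d + 1)"
      using monomial[of "d + 1"] by auto
  next
    assume "\<sigma> (d + 1) = \<mu> (d + 1)"
    with that have "\<forall>k\<le>d + 1. \<sigma> k = \<mu> k"
      by (auto simp: le_Suc_eq)
    then show "\<forall>p. degree p = d + 1 \<longrightarrow> I (poly p) = Q (poly p)"
      using exact by (metis order_refl)
  qed
  ultimately show ?prec
    unfolding has_degree_of_precision_def by blast
qed

theorem proposition3p5:
  fixes \<alpha> lam h t0 :: real and n j \<nu> d :: nat
    and b :: "nat \<Rightarrow> nat \<Rightarrow> real" and c :: "nat \<Rightarrow> real"
  assumes "\<alpha> > 0" and "h > 0" and "j < n"
    and "\<And>r. r \<in> {1..\<nu>} \<Longrightarrow> c r \<in> {0..1}"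
  shows "(exact_up_to_degree (ml_integral \<alpha> lam t0 h n j) (quad_rule \<nu> b c t0 h n j) d
            \<longleftrightarrow> (\<forall>k\<le>d. (\<Sum>r=1..\<nu>. b r (n - j) * c r ^ k)
                          = order_R \<alpha> h k (n - j) (h powr \<alpha> * lam)))
       \<and> (has_degree_of_precision (ml_integral \<alpha> lam t0 h n j) (quad_rule \<nu> b c t0 h n j) d
            \<longleftrightarrow> (\<forall>k\<le>d. (\<Sum>r=1..\<nu>. b r (n - j) * c r ^ k)
                          = order_R \<alpha> h k (n - j) (h powr \<alpha> * lam))
              \<and> (\<Sum>r=1..\<nu>. b r (n - j) * c r ^ (d + 1))
                          \<noteq> order_R \<alpha> h (d + 1) (n - j) (h powr \<alpha> * lam))"
proof -
  have "h \<noteq> 0"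
    using assms by simp
  \<comment> \<open>Here \<open>a\<close> is \<open>mesh t0 h j\<close>, \<open>\<mu>\<close> is
    given by \<open>order_R\<close> and \<open>\<sigma>\<close> by the weighted power sums of the
    nodes.\<close>
  note moments = exact_degree_iff_moments[OF this ml_integral_poly[OF assms(1-3)]
      quad_rule_poly[OF this]]
  show ?thesis
    by (intro conjI moments)
qed

end
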